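(* Let $k$ be a field, $G$ a torsion-free group and $\mathcal B$ a $\Phi$-set theoretic basis of $k[G]$. Then, as a set, $\mathcal B=\lambda G=\{\lambda g\mid g\in G\}$ for some $\lambda\in k^*$. In particular, the set-theoretic solution $\phi_{\mathcal B}$ on $\mathcal B$ is equivalent to the group solution $(g,h)\mapsto(g,gh)$ on $G$.
   Context: $\Phi_{k[G]}$ is the linear map on $k[G]\otimes k[G]$ with $g\otimes h\mapsto g\otimes gh$ for $g,h\in G$. A basis $\mathcal B$ of $k[G]$ is $\Phi$-set theoretic if for all $b,c\in\mathcal B$ there are $b',c'\in\mathcal B$ with $\Phi_{k[G]}(b\otimes c)=b'\otimes c'$; then $\phi_{\mathcal B}:\mathcal B\times\mathcal B\to\mathcal B\times\mathcal B$, $\phi_{\mathcal B}(b,c)=(b',c')$. Set-theoretic solutions $s$ on $S$ and $t$ on $T$ (maps $S\times S\to S\times S$, $T\times T\to T\times T$) are equivalent if there is a bijection $f:S\to T$ with $(f\times f)s=t(f\times f)$. *)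

theory Defs
  imports Complex_Main "HOL-Library.Poly_Mapping"
begin

text \<open>
  Groups are types of class \<^class>\<open>group_add\<close>, which is not assumed commutative: the group
  operation is written additively, so \<open>g + h\<close> is the product $gh$ and \<open>0\<close> is the neutral
  element. The group algebra $k[G]$ is \<open>'g \<Rightarrow>\<^sub>0 'k\<close>, on which \<^theory>\<open>HOL-Library.Poly_Mapping\<close>
  puts the convolution product; the group element $g$ is \<open>Poly_Mapping.single g 1\<close>.
\<close>

definition torsion_free :: "'g::group_add itself \<Rightarrow> bool" where
  "torsion_free _ \<longleftrightarrow> (\<forall>(g::'g) n::nat. n > 0 \<and> ((+) g ^^ n) 0 = 0 \<longrightarrow> g = 0)"

definition scl :: "'k::field \<Rightarrow> ('a \<Rightarrow>\<^sub>0 'k) \<Rightarrow> ('a \<Rightarrow>\<^sub>0 'k)" where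
  "scl c p = Poly_Mapping.map ((*) c) p"

abbreviation gelem :: "'g \<Rightarrow> ('g \<Rightarrow>\<^sub>0 'k::field)" where
  "gelem g \<equiv> Poly_Mapping.single g 1"

lemma lookup_scl [simp]: "Poly_Mapping.lookup (scl c p) x = c * Poly_Mapping.lookup p x"
  by (simp add: scl_def Poly_Mapping.map.rep_eq when_def)

global_interpretation kvec: vector_space "scl :: 'k::field \<Rightarrow> ('a \<Rightarrow>\<^sub>0 'k) \<Rightarrow> ('a \<Rightarrow>\<^sub>0 'k)"
  by unfold_locales (auto intro!: poly_mapping_eqI simp: lookup_add algebra_simps)

definition is_basis :: "('a \<Rightarrow>\<^sub>0 'k::field) set \<Rightarrow> bool" where
  "is_basis B \<longleftrightarrow> kvec.independent B \<and> kvec.span B = UNIV"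

text \<open>
  The tensor product of the free vector spaces on \<open>'a\<close> and \<open>'b\<close> is realised as the free vector
  space on \<open>'a \<times> 'b\<close>, with pure tensors $(a \otimes b)(x,y) = a(x)\,b(y)$. The lemmas
  \<open>tensor_bilinear\<close> and \<open>tensor_universal\<close> below are its universal property.
\<close>

lift_definition tensor :: "('a \<Rightarrow>\<^sub>0 'k::field) \<Rightarrow> ('b \<Rightarrow>\<^sub>0 'k) \<Rightarrow> ('a \<times> 'b \<Rightarrow>\<^sub>0 'k)"  (infixl "\<otimes>\<^sub>k" 70)
  is "\<lambda>a b (x, y). a x * b y"
proof -
  fix f :: "'a \<Rightarrow> 'k" and g :: "'b \<Rightarrow> 'k"
  assume "finite {x. f x \<noteq> 0}" "finite {x. g x \<noteq> 0}"
  then have "finite ({x. f x \<noteq> 0} \<times> {y. g y \<noteq> 0})" by simp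
  then show "finite {p. (case p of (x, y) \<Rightarrow> f x * g y) \<noteq> 0}"
    by (rule rev_finite_subset) auto
qed

lemma lookup_tensor [simp]:
  "Poly_Mapping.lookup (a \<otimes>\<^sub>k b) (x, y) = Poly_Mapping.lookup a x * Poly_Mapping.lookup b y"
  by (simp add: tensor.rep_eq)

lemma tensor_gelem: "gelem x \<otimes>\<^sub>k gelem y = (gelem (x, y) :: 'a \<times> 'b \<Rightarrow>\<^sub>0 'k::field)"
  by (rule poly_mapping_eqI) (auto simp: lookup_single when_def split: prod.splits if_splits)

definition bilinear_map ::
  "('k::field \<Rightarrow> 'w::ab_group_add \<Rightarrow> 'w) \<Rightarrow> (('a \<Rightarrow>\<^sub>0 'k) \<Rightarrow> ('b \<Rightarrow>\<^sub>0 'k) \<Rightarrow> 'w) \<Rightarrow> bool" where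
  "bilinear_map s \<beta> \<longleftrightarrow>
    (\<forall>b. Vector_Spaces.linear scl s (\<lambda>a. \<beta> a b)) \<and> (\<forall>a. Vector_Spaces.linear scl s (\<beta> a))"

lemma tensor_bilinear:
  "bilinear_map scl (\<lambda>a b. a \<otimes>\<^sub>k b :: 'a \<times> 'b \<Rightarrow>\<^sub>0 'k::field)"
  unfolding bilinear_map_def
  by (intro conjI allI; unfold_locales; rule poly_mapping_eqI)
     (auto simp: lookup_add algebra_simps split: prod.splits)

definition linear_ext ::
  "('k::field \<Rightarrow> 'w::ab_group_add \<Rightarrow> 'w) \<Rightarrow> ('a \<Rightarrow> 'w) \<Rightarrow> ('a \<Rightarrow>\<^sub>0 'k) \<Rightarrow> 'w" where
  "linear_ext s f t = (\<Sum>x\<in>Poly_Mapping.keys t. s (Poly_Mapping.lookup t x) (f x))"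

lemma linear_ext_superset:
  assumes "vector_space s" "finite A" "Poly_Mapping.keys t \<subseteq> A"
  shows "linear_ext s f t = (\<Sum>x\<in>A. s (Poly_Mapping.lookup t x) (f x))"
proof -
  interpret vector_space s by fact
  show ?thesis unfolding linear_ext_def
    by (rule sum.mono_neutral_left) (use assms in \<open>auto simp: in_keys_iff\<close>)
qed

lemma linear_linear_ext:
  assumes s: "vector_space s"
  shows "Vector_Spaces.linear scl s (linear_ext s f)"
proof -
  interpret vector_space s by fact
  have add: "linear_ext s f (t + u) = linear_ext s f t + linear_ext s f u" for t u
  proof -
    let ?A = "Poly_Mapping.keys t \<union> Poly_Mapping.keys u"
    have "Poly_Mapping.keys (t + u) \<subseteq> ?A" by (rule keys_add)
    then show ?thesis
      using linear_ext_superset[OF s, of ?A "t + u" f] linear_ext_superset[OF s, of ?A t f]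
        linear_ext_superset[OF s, of ?A u f]
      by (simp add: lookup_add scale_left_distrib sum.distrib)
  qed
  have scale: "linear_ext s f (scl c t) = s c (linear_ext s f t)" for c t
  proof -
    have "Poly_Mapping.keys (scl c t) \<subseteq> Poly_Mapping.keys t"
      by (auto simp: in_keys_iff)
    then show ?thesis
      using linear_ext_superset[OF s, of "Poly_Mapping.keys t" "scl c t" f]
      by (simp add: linear_ext_def scale_sum_right)
  qed
  show ?thesis by unfold_locales (simp_all add: add scale)
qed

lemma linear_ext_gelem: "vector_space s \<Longrightarrow> linear_ext s f (gelem x) = f x"
  by (simp add: linear_ext_def vector_space.vector_space_assms(4))

lemma gelem_expansion: "t = (\<Sum>x\<in>Poly_Mapping.keys t. scl (Poly_Mapping.lookup t x) (gelem x))"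
  by (rule poly_mapping_eqI)
     (auto simp: lookup_sum lookup_single when_def sum.delta in_keys_iff if_distrib cong: if_cong)

lemma linear_eq_linear_ext:
  assumes "Vector_Spaces.linear scl s L" "\<And>x. L (gelem x) = f x"
  shows "L t = linear_ext s f t"
proof -
  interpret L: Vector_Spaces.linear scl s L by fact
  have "L t = L (\<Sum>x\<in>Poly_Mapping.keys t. scl (Poly_Mapping.lookup t x) (gelem x))"
    using gelem_expansion[of t] by simp
  also have "\<dots> = linear_ext s f t"
    by (simp add: L.sum L.scale assms(2) linear_ext_def)
  finally show ?thesis .
qed

lemma tensor_universal:
  fixes s :: "'k::field \<Rightarrow> 'w::ab_group_add \<Rightarrow> 'w"
    and \<beta> :: "('a \<Rightarrow>\<^sub>0 'k) \<Rightarrow> ('b \<Rightarrow>\<^sub>0 'k) \<Rightarrow> 'w"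
  assumes s: "vector_space s" and \<beta>: "bilinear_map s \<beta>"
  shows "\<exists>!L. Vector_Spaces.linear scl s L \<and> (\<forall>a b. L (a \<otimes>\<^sub>k b) = \<beta> a b)"
proof (rule ex1I)
  let ?L = "linear_ext s (\<lambda>(x, y). \<beta> (gelem x) (gelem y))"
  have L: "Vector_Spaces.linear scl s ?L" by (rule linear_linear_ext[OF s])
  have tl: "Vector_Spaces.linear scl scl (\<lambda>a. a \<otimes>\<^sub>k b :: 'a \<times> 'b \<Rightarrow>\<^sub>0 'k)"
    and tr: "Vector_Spaces.linear scl scl (\<lambda>b. a \<otimes>\<^sub>k b :: 'a \<times> 'b \<Rightarrow>\<^sub>0 'k)"
    for a :: "'a \<Rightarrow>\<^sub>0 'k" and b :: "'b \<Rightarrow>\<^sub>0 'k"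
    using tensor_bilinear unfolding bilinear_map_def by auto
  have 1: "?L (gelem x \<otimes>\<^sub>k b) = \<beta> (gelem x) b" for x b
  proof -
    have "Vector_Spaces.linear scl s (\<lambda>b. ?L (gelem x \<otimes>\<^sub>k b))"
      using Vector_Spaces.linear_compose[OF tr L] by (simp add: o_def)
    then have "?L (gelem x \<otimes>\<^sub>k b) = linear_ext s (\<lambda>y. \<beta> (gelem x) (gelem y)) b"
      by (rule linear_eq_linear_ext) (simp add: tensor_gelem linear_ext_gelem[OF s])
    moreover have "\<beta> (gelem x) b = linear_ext s (\<lambda>y. \<beta> (gelem x) (gelem y)) b"
      by (rule linear_eq_linear_ext) (use \<beta> in \<open>auto simp: bilinear_map_def\<close>)
    ultimately show ?thesis by simp
  qed
  have 2: "?L (a \<otimes>\<^sub>k b) = \<beta> a b" for a b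
  proof -
    have "Vector_Spaces.linear scl s (\<lambda>a. ?L (a \<otimes>\<^sub>k b))"
      using Vector_Spaces.linear_compose[OF tl L] by (simp add: o_def)
    then have "?L (a \<otimes>\<^sub>k b) = linear_ext s (\<lambda>x. \<beta> (gelem x) b) a"
      by (rule linear_eq_linear_ext) (rule 1)
    moreover have "\<beta> a b = linear_ext s (\<lambda>x. \<beta> (gelem x) b) a"
      by (rule linear_eq_linear_ext[where L = "\<lambda>a. \<beta> a b"])
         (use \<beta> in \<open>auto simp: bilinear_map_def\<close>)
    ultimately show ?thesis by simp
  qed
  show "Vector_Spaces.linear scl s ?L \<and> (\<forall>a b. ?L (a \<otimes>\<^sub>k b) = \<beta> a b)"
    using L 2 by blast
  fix M assume M: "Vector_Spaces.linear scl s M \<and> (\<forall>a b. M (a \<otimes>\<^sub>k b) = \<beta> a b)"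
  show "M = ?L"
  proof
    fix t
    have g: "M (gelem p) = (case p of (x, y) \<Rightarrow> \<beta> (gelem x) (gelem y))" for p
    proof (cases p)
      case (Pair x y)
      then show ?thesis using M tensor_gelem[of x y, where 'k = 'k] by (metis case_prod_conv)
    qed
    show "M t = ?L t" by (rule linear_eq_linear_ext) (use M g in auto)
  qed
qed

definition \<Phi> :: "('g::group_add \<times> 'g \<Rightarrow>\<^sub>0 'k::field) \<Rightarrow> ('g \<times> 'g \<Rightarrow>\<^sub>0 'k)" where
  "\<Phi> = linear_ext scl (\<lambda>(g, h). gelem g \<otimes>\<^sub>k gelem (g + h))"

lemma linear_\<Phi>: "Vector_Spaces.linear scl scl \<Phi>"
  unfolding \<Phi>_def by (rule linear_linear_ext) (rule kvec.vector_space_axioms)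

lemma \<Phi>_gelem: "\<Phi> (gelem g \<otimes>\<^sub>k gelem h) = gelem g \<otimes>\<^sub>k gelem (g + h)"
  by (simp add: \<Phi>_def tensor_gelem linear_ext_gelem kvec.vector_space_axioms)

definition \<Phi>_set_theoretic_basis :: "('g::group_add \<Rightarrow>\<^sub>0 'k::field) set \<Rightarrow> bool" where
  "\<Phi>_set_theoretic_basis B \<longleftrightarrow> is_basis B \<and>
    (\<forall>b\<in>B. \<forall>c\<in>B. \<exists>b'\<in>B. \<exists>c'\<in>B. \<Phi> (b \<otimes>\<^sub>k c) = b' \<otimes>\<^sub>k c')"

text \<open>
  The pair $(b',c')$ is unique because \<open>B\<close> is linearly independent (lemma \<open>basis_tensor_inj\<close>).
  Outside \<open>B \<times> B\<close> the value is irrelevant.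
\<close>

definition \<phi> :: "('g::group_add \<Rightarrow>\<^sub>0 'k::field) set \<Rightarrow>
    ('g \<Rightarrow>\<^sub>0 'k) \<times> ('g \<Rightarrow>\<^sub>0 'k) \<Rightarrow> ('g \<Rightarrow>\<^sub>0 'k) \<times> ('g \<Rightarrow>\<^sub>0 'k)" where
  "\<phi> B = (\<lambda>(b, c). THE p. p \<in> B \<times> B \<and> \<Phi> (b \<otimes>\<^sub>k c) = fst p \<otimes>\<^sub>k snd p)"

lemma basis_tensor_inj:
  fixes B :: "('a \<Rightarrow>\<^sub>0 'k::field) set"
  assumes B: "is_basis B" and mem: "b \<in> B" "c \<in> B" "b' \<in> B" "c' \<in> B"
    and eq: "b \<otimes>\<^sub>k c = b' \<otimes>\<^sub>k c'"
  shows "b = b' \<and> c = c'"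
proof -
  have ind: "kvec.independent B" using B by (simp add: is_basis_def)
  have nz: "v \<noteq> 0" if "v \<in> B" for v
    using ind that kvec.dependent_zero by blast
  have proportional: "v = w" if "v \<in> B" "w \<in> B" "v = scl r w" for v w r
  proof (rule ccontr)
    assume "v \<noteq> w"
    then have "w \<in> kvec.span (B - {v})"
      using that(2) by (intro kvec.span_base) auto
    then have "v \<in> kvec.span (B - {v})"
      by (subst that(3)) (rule kvec.span_scale)
    then show False using ind that(1) kvec.dependent_def by blast
  qed
  have e: "Poly_Mapping.lookup b x * Poly_Mapping.lookup c y
    = Poly_Mapping.lookup b' x * Poly_Mapping.lookup c' y" for x y
    using eq by (metis lookup_tensor)
  obtain x where x: "Poly_Mapping.lookup b x \<noteq> 0"
    using nz[OF mem(1)] by (metis lookup_zero poly_mapping_eqI)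
  obtain y where y: "Poly_Mapping.lookup c y \<noteq> 0"
    using nz[OF mem(2)] by (metis lookup_zero poly_mapping_eqI)
  have "b = scl (Poly_Mapping.lookup c' y / Poly_Mapping.lookup c y) b'"
    by (rule poly_mapping_eqI) (use e y in \<open>simp add: field_simps\<close>)
  moreover have "c = scl (Poly_Mapping.lookup b' x / Poly_Mapping.lookup b x) c'"
    by (rule poly_mapping_eqI) (use e x in \<open>simp add: field_simps\<close>)
  ultimately show ?thesis using proportional mem by blast
qed

lemma \<phi>_characterization:
  assumes B: "\<Phi>_set_theoretic_basis B" and "b \<in> B" "c \<in> B"
  shows "\<phi> B (b, c) = (b', c') \<longleftrightarrow> b' \<in> B \<and> c' \<in> B \<and> \<Phi> (b \<otimes>\<^sub>k c) = b' \<otimes>\<^sub>k c'"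
proof -
  have "\<exists>!p. p \<in> B \<times> B \<and> \<Phi> (b \<otimes>\<^sub>k c) = fst p \<otimes>\<^sub>k snd p"
  proof (rule ex_ex1I)
    show "\<exists>p. p \<in> B \<times> B \<and> \<Phi> (b \<otimes>\<^sub>k c) = fst p \<otimes>\<^sub>k snd p"
      using assms unfolding \<Phi>_set_theoretic_basis_def by fastforce
    show "p = q" if "p \<in> B \<times> B \<and> \<Phi> (b \<otimes>\<^sub>k c) = fst p \<otimes>\<^sub>k snd p"
      "q \<in> B \<times> B \<and> \<Phi> (b \<otimes>\<^sub>k c) = fst q \<otimes>\<^sub>k snd q" for p q
      using that basis_tensor_inj[of B "fst p" "snd p" "fst q" "snd q"] B
      unfolding \<Phi>_set_theoretic_basis_def by (auto simp: prod_eq_iff mem_Times_iff)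
  qed
  from theI'[OF this] the1_equality[OF this, of "(b', c')"] show ?thesis
    unfolding \<phi>_def by (auto simp: mem_Times_iff)
qed

definition equivalent_solutions ::
  "'s set \<Rightarrow> ('s \<times> 's \<Rightarrow> 's \<times> 's) \<Rightarrow> 't set \<Rightarrow> ('t \<times> 't \<Rightarrow> 't \<times> 't) \<Rightarrow> bool" where
  "equivalent_solutions S s T t \<longleftrightarrow>
    s ` (S \<times> S) \<subseteq> S \<times> S \<and> t ` (T \<times> T) \<subseteq> T \<times> T \<and>
    (\<exists>f. bij_betw f S T \<and>
      (\<forall>p\<in>S \<times> S. map_prod f f (s p) = t (map_prod f f p)))"

definition group_solution :: "'g::group_add \<times> 'g \<Rightarrow> 'g \<times> 'g" where
  "group_solution = (\<lambda>(g, h). (g, g + h))"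

end

(*
  On functions, Phi(b \<otimes> c) is (x, y) \<mapsto> b(x) c(x^-1 y). If this factors as b'(x) c'(y), then any
  two translates x c with x in the support of b are proportional to c'. Hence the finite support of
  c is stable under translation by x^-1 z for x, z in the support of b, which for torsion-free G
  forces x = z. So every basis vector is a multiple of a single group element, and comparing
  coefficients in Phi(\<mu> g \<otimes> \<lambda> 1) = \<mu> g \<otimes> \<mu> g gives \<mu> = \<lambda>.
*)
theory Submission
  imports Defs
begin

text \<open>The map (g, h) \<mapsto> (g, g + h) is a bijection with inverse (x, y) \<mapsto> (x, - x
  + y), so at most one term of the linear extension contributes to the coefficient at (x,
  y).\<close>

lemma lookup_\<Phi>:
  fixes x y :: "'g::group_add"
  shows "Poly_Mapping.lookup (\<Phi> t) (x, y) = Poly_Mapping.lookup t (x, - x + y)"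
proof -
  have "(fst p = x \<and> fst p + snd p = y) \<longleftrightarrow> p = (x, - x + y)" for p :: "'g \<times> 'g"
    by (cases p) (auto simp: add.assoc[symmetric])
  then show ?thesis
    unfolding \<Phi>_def linear_ext_def
    by (auto simp: lookup_sum tensor_gelem lookup_single when_def split_beta if_distrib
        sum.delta in_keys_iff cong: if_cong)
qed

lemma funpow_plus_left: "((+) g ^^ n) s = ((+) g ^^ n) 0 + (s :: 'g::group_add)"
  by (induction n) (simp_all add: add.assoc)

text \<open>Pigeonhole: the iterates of \<open>s\<close> under translation by \<open>g\<close> stay
  in the finite set \<open>S\<close>, so two of them coincide, and cancellation turns this into a
  vanishing positive multiple of \<open>g\<close>.\<close>

lemma torsion_free_finite_invariant:
  fixes g :: "'g::group_add"
  assumes tf: "torsion_free TYPE('g)" and S: "finite S" "s \<in> S"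
    and inv: "\<And>y. y \<in> S \<Longrightarrow> g + y \<in> S"
  shows "g = 0"
proof -
  have mem: "((+) g ^^ n) s \<in> S" for n
    by (induction n) (simp_all add: S inv)
  have "\<not> inj (\<lambda>n. ((+) g ^^ n) s)"
    using mem S(1) by (meson finite_subset image_subsetI infinite_UNIV_nat finite_imageD)
  then obtain m n where mn: "m < n" "((+) g ^^ m) s = ((+) g ^^ n) s"
    unfolding inj_on_def by (metis linorder_neqE_nat)
  \<comment> \<open>\<open>a n\<close> is the n-fold multiple of \<open>g\<close>; cancelling
    \<open>s\<close> on the right in the coincidence of iterates leaves
    \<open>a m = a n\<close>.\<close>
  define a where "a = (\<lambda>n. ((+) g ^^ n) 0)"
  have "a m = a n"
    using mn(2) funpow_plus_left[of m g s] funpow_plus_left[of n g s] by (simp add: a_def)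
  moreover have "a n = a m + a (n - m)"
  proof -
    have "((+) g ^^ n) 0 = ((+) g ^^ m) (((+) g ^^ (n - m)) 0)"
      using mn(1) by (metis add_diff_inverse_nat comp_apply funpow_add less_imp_not_less)
    then show ?thesis unfolding a_def using funpow_plus_left by metis
  qed
  ultimately have "((+) g ^^ (n - m)) 0 = 0"
    unfolding a_def by (metis add_0_right add_left_cancel)
  then show ?thesis using tf mn(1) unfolding torsion_free_def by (meson zero_less_diff)
qed

lemma \<Phi>_pure_tensor_support:
  fixes b c :: "'g::group_add \<Rightarrow>\<^sub>0 'k::field"
  assumes tf: "torsion_free TYPE('g)" and c: "c \<noteq> 0" and eq: "\<Phi> (b \<otimes>\<^sub>k c) = b' \<otimes>\<^sub>k c'"
    and x: "Poly_Mapping.lookup b x \<noteq> 0" and z: "Poly_Mapping.lookup b z \<noteq> 0"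
  shows "x = z"
proof -
  have e: "Poly_Mapping.lookup b u * Poly_Mapping.lookup c (- u + y)
    = Poly_Mapping.lookup b' u * Poly_Mapping.lookup c' y" for u y
    using lookup_\<Phi>[of "b \<otimes>\<^sub>k c" u y] eq by simp
  obtain s where s: "s \<in> Poly_Mapping.keys c"
    using c by (metis ex_in_conv keys_eq_empty)
  \<comment> \<open>At y = x + s the left side of \<open>e\<close> is b(x) c(s), a product of
    nonzero scalars.\<close>
  have nz: "Poly_Mapping.lookup b' x \<noteq> 0"
    using e[of x "x + s"] x s by (auto simp: in_keys_iff)
  have "- x + z = 0"
  proof (rule torsion_free_finite_invariant[OF tf finite_keys s])
    \<comment> \<open>Equation \<open>e\<close> at u = z carries y from the support of
      \<open>c\<close> to z + y in that of \<open>c'\<close>; at u = x, where \<open>b'\<close> is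
      nonzero, it carries z + y back to - x + z + y in the support of \<open>c\<close>.\<close>
    fix y assume "y \<in> Poly_Mapping.keys c"
    then have "Poly_Mapping.lookup c' (z + y) \<noteq> 0"
      using e[of z "z + y"] z by (auto simp: in_keys_iff)
    then show "- x + z + y \<in> Poly_Mapping.keys c"
      using e[of x "z + y"] nz by (auto simp: in_keys_iff add.assoc)
  qed
  then show ?thesis by (metis add.inverse_inverse minus_unique)
qed

lemma basis_proportional_eq:
  assumes "is_basis B" "v \<in> B" "w \<in> B" "v = scl r w"
  shows "v = w"
proof (rule ccontr)
  assume "v \<noteq> w"
  then have "v \<in> kvec.span (B - {v})"
    using assms(3) by (subst assms(4), intro kvec.span_scale kvec.span_base) auto
  then show False using assms(1,2) unfolding is_basis_def kvec.dependent_def by blast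
qed

text \<open>Otherwise the span of \<open>B\<close> would lie in the hyperplane of vectors vanishing
  at \<open>g\<close>, which misses \<open>gelem g\<close>.\<close>

lemma basis_lookup_nonzero:
  fixes B :: "('a \<Rightarrow>\<^sub>0 'k::field) set"
  assumes "is_basis B"
  obtains b where "b \<in> B" "Poly_Mapping.lookup b g \<noteq> 0"
proof -
  have "\<exists>b\<in>B. Poly_Mapping.lookup b g \<noteq> 0"
  proof (rule ccontr)
    let ?V = "{v :: 'a \<Rightarrow>\<^sub>0 'k. Poly_Mapping.lookup v g = 0}"
    assume "\<not> ?thesis"
    then have "B \<subseteq> ?V" by auto
    moreover have "kvec.subspace ?V" by (auto simp: kvec.subspace_def lookup_add)
    ultimately have "gelem g \<in> ?V"
      using kvec.span_minimal[of B ?V] assms unfolding is_basis_def by blast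
    then show False by simp
  qed
  then show thesis using that by blast
qed

lemma \<Phi>_set_theoretic_basis_eq:
  fixes B :: "('g::group_add \<Rightarrow>\<^sub>0 'k::field) set"
  assumes tf: "torsion_free TYPE('g)" and B: "\<Phi>_set_theoretic_basis B"
  shows "\<exists>c. c \<noteq> 0 \<and> B = range (\<lambda>g. scl c (gelem g))"
proof -
  have basis: "is_basis B" using B by (simp add: \<Phi>_set_theoretic_basis_def)
  have nz: "v \<noteq> 0" if "v \<in> B" for v
    using basis that kvec.dependent_zero unfolding is_basis_def by blast
  have mono: "v = scl (Poly_Mapping.lookup v g) (gelem g)"
    if v: "v \<in> B" and g: "Poly_Mapping.lookup v g \<noteq> 0" for v g
  proof (rule poly_mapping_eqI)
    fix h
    \<comment> \<open>The support argument asks of the second factor only that it be nonzero, so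
      \<open>v\<close> can serve as both factors.\<close>
    obtain b' c' where "\<Phi> (v \<otimes>\<^sub>k v) = b' \<otimes>\<^sub>k c'"
      using B v unfolding \<Phi>_set_theoretic_basis_def by blast
    then have "Poly_Mapping.lookup v h \<noteq> 0 \<Longrightarrow> g = h"
      using \<Phi>_pure_tensor_support[OF tf nz[OF v]] g by blast
    then show "Poly_Mapping.lookup v h
        = Poly_Mapping.lookup (scl (Poly_Mapping.lookup v g) (gelem g)) h"
      by (auto simp: lookup_single when_def)
  qed
  \<comment> \<open>By \<open>mono\<close> both vectors are multiples of the same
    \<open>gelem g\<close>, and independence excludes distinct proportional vectors.\<close>
  have uniq: "v = w" if "v \<in> B" "w \<in> B" "Poly_Mapping.lookup v g \<noteq> 0"
    "Poly_Mapping.lookup w g \<noteq> 0" for v w g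
  proof (rule basis_proportional_eq[OF basis that(1,2)])
    show "v = scl (Poly_Mapping.lookup v g / Poly_Mapping.lookup w g) w"
      using mono[OF that(1,3)] mono[OF that(2,4)] that(4)
      by (metis kvec.scale_scale nonzero_eq_divide_eq)
  qed
  \<comment> \<open>The basis vector over the neutral element supplies the common scalar.\<close>
  obtain e where e: "e \<in> B" "Poly_Mapping.lookup e 0 \<noteq> 0"
    using basis_lookup_nonzero[OF basis] .
  define c where "c = Poly_Mapping.lookup e 0"
  have coeff: "Poly_Mapping.lookup v g = c"
    if v: "v \<in> B" and g: "Poly_Mapping.lookup v g \<noteq> 0" for v g
  proof -
    obtain b' c' where bc: "b' \<in> B" "c' \<in> B" "\<Phi> (v \<otimes>\<^sub>k e) = b' \<otimes>\<^sub>k c'"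
      using B v e(1) unfolding \<Phi>_set_theoretic_basis_def by blast
    \<comment> \<open>The entry at (g, g) evaluates \<open>e\<close> at - g + g = 0, where its
      coefficient is \<open>c\<close>.\<close>
    have eq: "Poly_Mapping.lookup v g * c
        = Poly_Mapping.lookup b' g * Poly_Mapping.lookup c' g"
      using lookup_\<Phi>[of "v \<otimes>\<^sub>k e" g g] bc(3) by (simp add: c_def)
    with g e(2) have "Poly_Mapping.lookup b' g \<noteq> 0" "Poly_Mapping.lookup c' g \<noteq> 0"
      by (auto simp: c_def)
    \<comment> \<open>Both factors are nonzero at \<open>g\<close>, so each is \<open>v\<close>;
      then \<open>eq\<close> reads v(g) c = v(g) v(g), and v(g) cancels.\<close>
    then have "b' = v" "c' = v"
      using uniq[OF bc(1) v] uniq[OF bc(2) v] g by blast+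
    with eq g show ?thesis by simp
  qed
  have "B = range (\<lambda>g. scl c (gelem g))"
  proof (intro set_eqI iffI)
    fix v assume v: "v \<in> B"
    then obtain g where "Poly_Mapping.lookup v g \<noteq> 0"
      using nz by (metis lookup_zero poly_mapping_eqI)
    then show "v \<in> range (\<lambda>g. scl c (gelem g))"
      using mono[OF v] coeff[OF v] by (metis rangeI)
  next
    fix v :: "'g \<Rightarrow>\<^sub>0 'k" assume "v \<in> range (\<lambda>g. scl c (gelem g))"
    then obtain g where v: "v = scl c (gelem g)" by blast
    \<comment> \<open>Some basis vector lives over \<open>g\<close>; \<open>mono\<close> and
      \<open>coeff\<close> identify it with \<open>v\<close>.\<close>
    obtain w where "w \<in> B" "Poly_Mapping.lookup w g \<noteq> 0"
      using basis_lookup_nonzero[OF basis] .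
    then show "v \<in> B" using mono coeff v by metis
  qed
  then show ?thesis using e(2) c_def by blast
qed

text \<open>All basis vectors carry the same scalar, so \<Phi> multiplies them as it does group
  elements, with the factor c * c on both sides. The equivalence is the inverse of g \<mapsto>
  \<open>scl c (gelem g)\<close>.\<close>

lemma equivalent_group_solution:
  fixes B :: "('g::group_add \<Rightarrow>\<^sub>0 'k::field) set"
  assumes B: "\<Phi>_set_theoretic_basis B" and c: "c \<noteq> 0"
    and eq: "B = range (\<lambda>g. scl c (gelem g))"
  shows "equivalent_solutions B (\<phi> B) (UNIV :: 'g set) group_solution"
proof -
  let ?e = "\<lambda>g::'g. scl c (gelem g) :: 'g \<Rightarrow>\<^sub>0 'k"
  have inj: "inj ?e"
  proof (rule injI)
    fix g h assume "?e g = ?e h"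
    then have "Poly_Mapping.lookup (?e g) g = Poly_Mapping.lookup (?e h) g" by (simp only:)
    then show "g = h"
      using c by (simp only: lookup_scl lookup_single when_def) (simp split: if_splits)
  qed
  have \<phi>: "\<phi> B (?e g, ?e h) = (?e g, ?e (g + h))" for g h
  proof -
    have "\<Phi> (?e g \<otimes>\<^sub>k ?e h) = ?e g \<otimes>\<^sub>k ?e (g + h)"
    proof (rule poly_mapping_eqI)
      fix p :: "'g \<times> 'g"
      obtain x y where "p = (x, y)" by fastforce
      moreover have "h = - x + y \<longleftrightarrow> x + h = y" by (metis add_minus_cancel minus_add_cancel)
      ultimately show "Poly_Mapping.lookup (\<Phi> (?e g \<otimes>\<^sub>k ?e h)) p
          = Poly_Mapping.lookup (?e g \<otimes>\<^sub>k ?e (g + h)) p"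
        by (auto simp: lookup_\<Phi> lookup_single when_def)
    qed
    then show ?thesis using \<phi>_characterization[OF B] eq by blast
  qed
  have pair: "\<exists>g h. p = (?e g, ?e h)" if "p \<in> B \<times> B" for p
    by (cases p) (use that eq in blast)
  have "bij_betw (inv ?e) B UNIV"
    using inj eq by (metis bij_betw_imageI bij_betw_inv_into)
  moreover have "map_prod (inv ?e) (inv ?e) (\<phi> B p) = group_solution (map_prod (inv ?e) (inv ?e) p)"
    if mem: "p \<in> B \<times> B" for p
  proof -
    obtain g h where p: "p = (?e g, ?e h)" using pair[OF mem] by blast
    show ?thesis
      unfolding p \<phi> map_prod_simp group_solution_def case_prod_conv inv_f_f[OF inj] ..
  qed
  moreover have "\<phi> B ` (B \<times> B) \<subseteq> B \<times> B"
  proof (rule image_subsetI)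
    fix p assume "p \<in> B \<times> B"
    then obtain g h where p: "p = (?e g, ?e h)" using pair by blast
    show "\<phi> B p \<in> B \<times> B" unfolding p \<phi> using eq by blast
  qed
  ultimately show ?thesis
    unfolding equivalent_solutions_def by (intro conjI subset_UNIV exI[of _ "inv ?e"] ballI) auto
qed

theorem corollary7p6:
  fixes B :: "('g::group_add \<Rightarrow>\<^sub>0 'k::field) set"
  assumes "torsion_free TYPE('g)"
    and "\<Phi>_set_theoretic_basis B"
  shows "(\<exists>c. c \<noteq> 0 \<and> B = {scl c (gelem g) | g. True}) \<and>
    equivalent_solutions B (\<phi> B) (UNIV :: 'g set) group_solution"
proof -
  obtain c where c: "c \<noteq> 0" "B = range (\<lambda>g. scl c (gelem g))"
    using \<Phi>_set_theoretic_basis_eq[OF assms] by blast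
  then show ?thesis
    using equivalent_group_solution[OF assms(2) c] by (auto simp: full_SetCompr_eq)
qed

end
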